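(* Let $\mathcal{L}$ be the Rogers dilogarithm, let $(f_k)_{k\in\mathbb{Z}}$ and $(l_k)_{k\in\mathbb{Z}}$ be the Fibonacci and Lucas numbers, and let $\phi=(1+\sqrt5)/2$. Let $\epsilon_1=1/2$ and $\epsilon_k=1$ for all integers $k\ge 2$. Then all of the following identities hold. (a) For every integer $n\ge 1$, $$\sum_{k=2}^{\infty}\mathcal{L}\left(\left(\frac{f_{2n}}{f_{2nk}}\right)^2\right)=\mathcal{L}\left(\left(\frac1\phi\right)^{4n}\right).$$ (b) (Case $n=1$.) $$\sum_{k=2}^{\infty}\mathcal{L}\left(\left(\frac{1}{f_{2k}}\right)^2\right)=\mathcal{L}(1/\phi^4),\qquad \sum_{k=1}^{\infty}\mathcal{L}\left(\frac{1}{f_{2k-3}f_{2k+1}}\right)=\mathcal{L}(1-1/\phi^4),$$ $$\sum_{k=1}^{\infty}\left(\mathcal{L}\left(\frac{1}{f_{2k+2}^2}\right)+\mathcal{L}\left(\frac{1}{f_{2k-3}f_{2k+1}}\right)\right)=\frac{\pi^2}{6}.$$ (c) (Case $n=2$.) $$\sum_{k=2}^{\infty}\mathcal{L}\left(\frac{3^2}{f_{4k}^2}\right)=\mathcal{L}(1/\phi^8),\qquad \sum_{k=0}^{\infty}\mathcal{L}\left(\frac{45}{l_{4k-2}\,l_{4k+6}}\right)=\mathcal{L}(1-1/\phi^8),$$ $$\sum_{k=2}^{\infty}\mathcal{L}\left(\frac{3^2}{f_{4k}^2}\right)+\sum_{k=0}^{\infty}\mathcal{L}\left(\frac{45}{l_{4k-2}\,l_{4k+6}}\right)=\frac{\pi^2}{6}.$$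 (d) For every integer $n\ge 0$, $$\sum_{k=2}^{\infty}\mathcal{L}\left(\frac{l_{2n+1}^2}{l_{k(4n+2)-(2n+1)}^2}\right)+\sum_{k=1}^{\infty}\mathcal{L}\left(\frac{l_{2n+1}^2}{5f_{k(4n+2)}^2}\right)=\mathcal{L}(1/\phi^{4n+2}).$$ (e) $$\sum_{k=1}^{\infty}\left(\mathcal{L}\left(\frac{1}{5f_{2k}^2}\right)+\mathcal{L}\left(\frac{1}{l_{2k+1}^2}\right)+\mathcal{L}\left(\frac{1}{l_{2k-2}l_{2k}}\right)+\epsilon_k\,\mathcal{L}\left(\frac{1}{5f_{2k-3}f_{2k-1}}\right)\right)=\frac{\pi^2}{6}.$$ (f) $$\sum_{k=1}^{\infty}\left(\mathcal{L}\left(\frac{1}{l_{2k-2}l_{2k}}\right)+\epsilon_k\,\mathcal{L}\left(\frac{1}{5f_{2k-3}f_{2k-1}}\right)\right)=\mathcal{L}(1/\phi)=\frac{\pi^2}{10}.$$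
   Context: The Rogers dilogarithm is the function on $[0,1]$ given by $\mathcal{L}(z)=\mathrm{Li}_2(z)+\frac12\log|z|\log(1-z)$, where $\mathrm{Li}_2(z)=\sum_{n\ge1}z^n/n^2$, with $\mathcal{L}(0)=0$ and $\mathcal{L}(1)=\pi^2/6$. The Fibonacci numbers are defined for all integers by $f_0=0$, $f_1=1$, $f_n=f_{n-1}+f_{n-2}$ for $n\in\mathbb{Z}$ (so $f_{-1}=1$, $f_2=1$, $f_3=2$, $f_4=3$). The Lucas numbers are defined for all integers by $l_0=2$, $l_1=1$, $l_n=l_{n-1}+l_{n-2}$ for $n\in\mathbb{Z}$ (so $l_{-2}=3$). *)

theory Defs
  imports "HOL-Analysis.Analysis" "HOL-Number_Theory.Fib"
begin

definition dilog :: "real \<Rightarrow> real" where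
  "dilog z = (\<Sum>n. z ^ (n + 1) / real (n + 1) ^ 2)"

text \<open>Only the values on the closed unit interval are meaningful.\<close>
definition rogers_dilog :: "real \<Rightarrow> real" where
  "rogers_dilog z =
     (if z = 0 then 0
      else if z = 1 then pi ^ 2 / 6
      else dilog z + 1 / 2 * ln \<bar>z\<bar> * ln (1 - z))"

text \<open>For negative indices the recurrence is run backwards.  The library has Fibonacci
  numbers with natural indices only; \<open>fibz_of_nat\<close> below relates the two.\<close>
function fibz :: "int \<Rightarrow> int" where
  "fibz n =
     (if n = 0 then 0
      else if n = 1 then 1
      else if n > 1 then fibz (n - 1) + fibz (n - 2)
      else fibz (n + 2) - fibz (n + 1))"
  by auto
termination
  by (relation "Wellfounded.measure (\<lambda>n. if n \<ge> 0 then nat n else nat (1 - n))") auto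

function lucasz :: "int \<Rightarrow> int" where
  "lucasz n =
     (if n = 0 then 2
      else if n = 1 then 1
      else if n > 1 then lucasz (n - 1) + lucasz (n - 2)
      else lucasz (n + 2) - lucasz (n + 1))"
  by auto
termination
  by (relation "Wellfounded.measure (\<lambda>n. if n \<ge> 0 then nat n else nat (1 - n))") auto

declare fibz.simps [simp del] lucasz.simps [simp del]

lemma fibz_0 [simp]: "fibz 0 = 0" and fibz_1 [simp]: "fibz 1 = 1"
  by (simp_all add: fibz.simps)

lemma lucasz_0 [simp]: "lucasz 0 = 2" and lucasz_1 [simp]: "lucasz 1 = 1"
  by (simp_all add: lucasz.simps)

lemma fibz_rec: "fibz n = fibz (n - 1) + fibz (n - 2)"
proof (cases "n > 1")
  case True
  then show ?thesis by (subst fibz.simps) simp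
next
  case False
  then have "fibz (n - 2) = fibz n - fibz (n - 1)"
    by (subst fibz.simps) simp
  then show ?thesis by simp
qed

lemma lucasz_rec: "lucasz n = lucasz (n - 1) + lucasz (n - 2)"
proof (cases "n > 1")
  case True
  then show ?thesis by (subst lucasz.simps) simp
next
  case False
  then have "lucasz (n - 2) = lucasz n - lucasz (n - 1)"
    by (subst lucasz.simps) simp
  then show ?thesis by simp
qed

lemma fibz_of_nat: "fibz (int n) = int (fib n)"
proof (induction n rule: fib.induct)
  case (3 n)
  have "fibz (int (Suc (Suc n))) = fibz (int (Suc n)) + fibz (int n)"
    using fibz_rec[of "int (Suc (Suc n))"] by simp
  with 3 show ?case by simp
qed simp_all

definition golden_ratio :: real where
  "golden_ratio = (1 + sqrt 5) / 2"

text \<open>Convergence of a series whose summation index is an integer running upwards from \<open>m\<close>.\<close>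
definition sums_from :: "(int \<Rightarrow> real) \<Rightarrow> int \<Rightarrow> real \<Rightarrow> bool" where
  "sums_from a m s \<longleftrightarrow> (\<lambda>j. a (m + int j)) sums s"

end

theory Submission
  imports Defs "HOL-Real_Asymp.Real_Asymp"
begin

text \<open>Every series telescopes by Abel's five-term relation
  \<open>L(x) + L(y) = L(xy) + L(x(1-y)/(1-xy)) + L(y(1-x)/(1-xy))\<close>.
  For \<open>q = 1/r^2\<close> and \<open>x = (1-q)/(1-q^k)\<close>, \<open>y = q^(k-1) x\<close> the last two arguments are the
  values of \<open>x\<close>, \<open>y\<close> at \<open>k+1\<close>, while \<open>xy\<close> is the square of \<open>(r - 1/r)/(r^k - 1/r^k)\<close>; hence
  the sum over \<open>k \<ge> 2\<close> is \<open>L(1) - L(1-q) = L(q)\<close>. With \<open>x = (1-q)/(1+t^2)\<close> and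
  \<open>y = (1-q)/(1+q^2/t^2)\<close> the relation expresses
  \<open>L((r - 1/r)^2 / ((t + 1/t)(t r^2 + 1/(t r^2))))\<close> as \<open>g(t) - g(t r)\<close>, where
  \<open>g(t) = L((1-q)/(1+t^2)) - L((1-q)/(1+q/t^2))\<close>. For \<open>r\<close> and \<open>t\<close> powers of the golden ratio,
  \<open>r^k - 1/r^k\<close> and \<open>t + 1/t\<close> are Lucas numbers or \<open>sqrt 5\<close> times Fibonacci numbers, depending
  on the parity of the exponent. The value \<open>L(1/\<phi>)\<close> is the case \<open>x = y = 1/\<phi>\<close> of the
  five-term relation combined with reflection.\<close>

section \<open>Analytic properties of the dilogarithm and the Rogers dilogarithm on the unit
  interval\<close>

lemma dilog_has_real_derivative:
  assumes "0 < x" "x < 1"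
  shows "(dilog has_real_derivative - ln (1 - x) / x) (at x)"
proof -
  have geom: "summable (\<lambda>n. y ^ n / real (Suc n))" if "\<bar>y\<bar> < 1" for y :: real
  proof (rule summable_comparison_test)
    show "summable (\<lambda>n. \<bar>y\<bar> ^ n)" using that by (intro summable_geometric) auto
    show "\<exists>N. \<forall>n\<ge>N. norm (y ^ n / real (Suc n)) \<le> \<bar>y\<bar> ^ n"
      by (auto simp: power_abs divide_simps mult_le_cancel_left1)
  qed
  have coeff: "1 / real (n + 1) ^ 2 * real (Suc n) * y ^ n = y ^ n / real (Suc n)" for y n
    by (simp add: power2_eq_square)
  have "((\<lambda>x. \<Sum>n. 1 / real (n + 1) ^ 2 * x ^ Suc n) has_real_derivative
          (\<Sum>n. 1 / real (n + 1) ^ 2 * real (Suc n) * x ^ n)) (at x)"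
  proof (rule DERIV_power_series'[where R = 1])
    show "summable (\<lambda>n. 1 / real (n + 1) ^ 2 * real (Suc n) * y ^ n)" if "y \<in> {-1<..<1}" for y
      unfolding coeff by (rule geom) (use that in auto)
  qed (use assms in auto)
  moreover have "(\<lambda>x. \<Sum>n. 1 / real (n + 1) ^ 2 * x ^ Suc n) = dilog"
    by (simp add: dilog_def fun_eq_iff)
  moreover have "(\<Sum>n. x ^ n / real (Suc n)) = - ln (1 - x) / x"
  proof -
    \<comment> \<open>The logarithm series runs in powers of (1 - x) - 1 = -x, so its alternating
      signs cancel and -x times the differentiated series remains.\<close>
    have "ln (1 - x) = (\<Sum>n. (-1) ^ n * (1 / real (n + 1)) * (1 - x - 1) ^ Suc n)"
      by (rule ln_series) (use assms in auto)
    also have "\<dots> = (\<Sum>n. - x * (x ^ n / real (Suc n)))"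
    proof (rule suminf_cong)
      fix n
      have "(-1) ^ n * (- x) ^ n = x ^ n" by (simp flip: power_mult_distrib)
      then have "(-1) ^ n * (1 / real (n + 1)) * (- x * (- x) ^ n) = - x * (x ^ n / real (n + 1))"
        by (metis mult.commute mult.left_commute mult_1 times_divide_eq_left)
      then show "(-1) ^ n * (1 / real (n + 1)) * (1 - x - 1) ^ Suc n = - x * (x ^ n / real (Suc n))"
        by simp
    qed
    also have "\<dots> = - x * (\<Sum>n. x ^ n / real (Suc n))"
      using geom[of x] assms by (intro suminf_mult) auto
    finally show ?thesis using assms by (simp add: field_simps)
  qed
  ultimately show ?thesis by (simp only: coeff)
qed

lemma summable_inverse_squares: "summable (\<lambda>n. 1 / real (n + 1) ^ 2)"
  using inverse_squares_sums by (simp add: sums_iff)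

text \<open>The inverse squares majorise the series up to and including both endpoints. Continuity
  there lets the functional equations be anchored at 0.\<close>

lemma continuous_on_dilog: "continuous_on {0..1} dilog"
proof (rule uniform_limit_theorem)
  show "uniform_limit {0..1} (\<lambda>n x. \<Sum>i<n. x ^ (i + 1) / real (i + 1) ^ 2) dilog sequentially"
    unfolding dilog_def
    by (rule Weierstrass_m_test[OF _ summable_inverse_squares])
       (auto simp: power_abs power_le_one mult_le_one intro!: divide_right_mono)
qed (auto intro!: always_eventually continuous_intros)

lemma dilog_0 [simp]: "dilog 0 = 0" and dilog_1 [simp]: "dilog 1 = pi ^ 2 / 6"
  using inverse_squares_sums by (simp_all add: dilog_def sums_iff add.commute)

lemma rogers_dilog_0 [simp]: "rogers_dilog 0 = 0" and rogers_dilog_1: "rogers_dilog 1 = pi ^ 2 / 6"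
  by (simp_all add: rogers_dilog_def)

text \<open>The two logarithms are both nonpositive, so their product is nonnegative. Nonnegativity
  later allows a series to be split by the parity of its index.\<close>

lemma rogers_dilog_nonneg:
  assumes "0 \<le> x" "x \<le> 1"
  shows "rogers_dilog x \<ge> 0"
proof -
  have "summable (\<lambda>n. x ^ (n + 1) / real (n + 1) ^ 2)"
    by (rule summable_comparison_test'[OF summable_inverse_squares, of 0])
       (use assms in \<open>auto simp: power_abs power_le_one mult_le_one intro!: divide_right_mono\<close>)
  then have "dilog x \<ge> 0"
    unfolding dilog_def using assms by (intro suminf_nonneg) auto
  moreover have "ln \<bar>x\<bar> * ln (1 - x) \<ge> 0" if "0 < x" "x < 1"
    using that by (intro mult_nonpos_nonpos) auto
  ultimately show ?thesis using assms by (auto simp: rogers_dilog_def)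
qed

text \<open>Half of the term -ln(1-x)/x survives the product rule, which leaves an expression
  symmetric under x -> 1 - x.\<close>

lemma rogers_dilog_has_real_derivative:
  assumes "0 < x" "x < 1"
  shows "(rogers_dilog has_real_derivative - (ln (1 - x) / x + ln x / (1 - x)) / 2) (at x)"
proof -
  have "((\<lambda>z. dilog z + 1 / 2 * ln z * ln (1 - z)) has_real_derivative
          - (ln (1 - x) / x + ln x / (1 - x)) / 2) (at x)"
    using assms
    by (auto intro!: derivative_eq_intros dilog_has_real_derivative simp: field_simps)
  moreover have "eventually (\<lambda>z. z \<in> {0<..<1}) (nhds x)"
    using assms by (intro eventually_nhds_in_open) auto
  then have "eventually (\<lambda>z. rogers_dilog z = dilog z + 1 / 2 * ln z * ln (1 - z)) (nhds x)"
    by eventually_elim (auto simp: rogers_dilog_def)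
  ultimately show ?thesis by (subst DERIV_cong_ev) auto
qed

text \<open>The product of logarithms tends to 0 at both ends, so \<open>p\<close>, its extension by
  0, is continuous. The values prescribed for L at 0 and 1 are those of \<open>dilog\<close>
  there.\<close>

lemma continuous_on_rogers_dilog: "continuous_on {0..1} rogers_dilog"
proof -
  define p where "p = (\<lambda>z::real. if z \<in> {0<..<1} then 1 / 2 * ln z * ln (1 - z) else 0)"
  have "continuous (at x within {0..1}) p" if x: "x \<in> {0..1}" for x
  proof -
    consider "x = 0" | "x = 1" | "x \<in> {0<..<1}" using x by force
    then show ?thesis
    proof cases
      case 1
      have "((\<lambda>z::real. 1 / 2 * ln z * ln (1 - z)) \<longlongrightarrow> 0) (at_right 0)"
        by real_asymp
      moreover have "eventually (\<lambda>z::real. z \<in> {0<..<1}) (at_right 0)"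
        by (rule eventually_at_right_real) simp
      ultimately have "(p \<longlongrightarrow> 0) (at_right 0)"
        by (rule Lim_transform_eventually[OF _ eventually_mono]) (simp add: p_def)
      with 1 show ?thesis
        by (simp add: continuous_within p_def at_within_Icc_at_right)
    next
      case 2
      have "((\<lambda>z::real. 1 / 2 * ln z * ln (1 - z)) \<longlongrightarrow> 0) (at_left 1)"
        by real_asymp
      moreover have "eventually (\<lambda>z::real. z \<in> {0<..<1}) (at_left 1)"
        by (rule eventually_at_left_real) simp
      ultimately have "(p \<longlongrightarrow> 0) (at_left 1)"
        by (rule Lim_transform_eventually[OF _ eventually_mono]) (simp add: p_def)
      with 2 show ?thesis
        by (simp add: continuous_within p_def at_within_Icc_at_left)
    next
      case 3
      then have "continuous (at x) (\<lambda>z. 1 / 2 * ln z * ln (1 - z))"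
        by (auto intro!: continuous_intros)
      moreover have "eventually (\<lambda>z. z \<in> {0<..<1}) (nhds x)"
        using 3 by (intro eventually_nhds_in_open) auto
      then have "eventually (\<lambda>z. p z = 1 / 2 * ln z * ln (1 - z)) (nhds x)"
        by eventually_elim (auto simp: p_def)
      ultimately have "continuous (at x) p" by (subst isCont_cong) auto
      then show ?thesis by (rule continuous_at_imp_continuous_at_within)
    qed
  qed
  then have "continuous_on {0..1} (\<lambda>z. dilog z + p z)"
    by (intro continuous_on_add continuous_on_dilog) (simp add: continuous_on_eq_continuous_within)
  then show ?thesis
    by (rule continuous_on_eq) (auto simp: p_def rogers_dilog_def)
qed

section \<open>Functional equations: reflection and the five-term relation\<close>

lemma rogers_dilog_reflection:
  assumes "0 \<le> x" "x \<le> 1"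
  shows "rogers_dilog x + rogers_dilog (1 - x) = pi ^ 2 / 6"
proof -
  let ?h = "\<lambda>z. rogers_dilog z + rogers_dilog (1 - z)"
  have "continuous_on {0..1} (\<lambda>z. rogers_dilog (1 - z))"
    by (rule continuous_on_compose2[OF continuous_on_rogers_dilog]) (auto intro!: continuous_intros)
  then have "continuous_on {0..1} ?h"
    by (intro continuous_on_add continuous_on_rogers_dilog)
  moreover have "(?h has_real_derivative 0) (at z)" if z: "0 < z" "z < 1" for z
  proof -
    have "((\<lambda>z. rogers_dilog (1 - z)) has_real_derivative
            (- (ln (1 - (1 - z)) / (1 - z) + ln (1 - z) / (1 - (1 - z))) / 2) * (0 - 1)) (at z)"
      using z by (intro DERIV_chain2[OF rogers_dilog_has_real_derivative]) (auto intro!: derivative_eq_intros)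
    from DERIV_add[OF rogers_dilog_has_real_derivative[OF z] this] show ?thesis
      by (simp add: add.commute)
  qed
  \<comment> \<open>By the symmetry of the derivative of L, \<open>?h\<close> is constant; its value
    is L(0) + L(1).\<close>
  ultimately have "?h x = ?h 0" using assms by (intro DERIV_isconst2[of 0 1]) auto
  then show ?thesis by (simp add: rogers_dilog_1)
qed

text \<open>For fixed y, the difference \<open>?h\<close> of the two sides as a function of x has
  derivative zero. At x = 0 the quotients become 0 and y, so the difference vanishes.\<close>

lemma rogers_dilog_five_term:
  assumes x: "0 < x" "x < 1" and y: "0 < y" "y < 1"
  shows "rogers_dilog x + rogers_dilog y =
    rogers_dilog (x * y) + rogers_dilog (x * (1 - y) / (1 - x * y)) + rogers_dilog (y * (1 - x) / (1 - x * y))"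
proof -
  let ?u = "\<lambda>z. z * (1 - y) / (1 - z * y)" and ?v = "\<lambda>z. y * (1 - z) / (1 - z * y)"
  let ?h = "\<lambda>z. rogers_dilog z + rogers_dilog y - rogers_dilog (z * y)
    - rogers_dilog (?u z) - rogers_dilog (?v z)"
  have zy: "z * y < 1" if "0 \<le> z" "z \<le> 1" for z
    using mult_right_mono[of z 1 y] that y by linarith
  \<comment> \<open>These factorisations turn the logarithms of u, v, 1 - u and 1 - v into
    combinations of ln z, ln (1 - z), ln y, ln (1 - y) and ln c.\<close>
  have u: "1 - ?u z = (1 - z) / (1 - z * y)" and v: "1 - ?v z = (1 - y) / (1 - z * y)"
    if "0 \<le> z" "z \<le> 1" for z
    using zy[OF that] by (simp_all add: field_simps)
  have u01: "?u z \<in> {0..1}" and v01: "?v z \<in> {0..1}" if "0 \<le> z" "z \<le> 1" for z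
  proof -
    have "?u z \<ge> 0" "?v z \<ge> 0" "1 - ?u z \<ge> 0" "1 - ?v z \<ge> 0"
      unfolding u[OF that] v[OF that] using zy[OF that] that y by simp_all
    then show "?u z \<in> {0..1}" "?v z \<in> {0..1}" by auto
  qed
  have cont: "continuous_on {0..1} ?h"
  proof (intro continuous_on_diff continuous_on_add continuous_on_rogers_dilog continuous_on_const;
         rule continuous_on_compose2[OF continuous_on_rogers_dilog])
    show "continuous_on {0..1} ?u" "continuous_on {0..1} ?v"
      using zy by (auto intro!: continuous_intros dest!: zy)
    show "continuous_on {0..1} (\<lambda>z. z * y)" by (intro continuous_intros)
    show "(\<lambda>z. z * y) ` {0..1} \<subseteq> {0..1}" using y less_imp_le[OF zy] by auto
    show "?u ` {0..1} \<subseteq> {0..1}" "?v ` {0..1} \<subseteq> {0..1}"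
      by (meson u01 v01 atLeastAtMost_iff image_subsetI)+
  qed
  have deriv: "(?h has_real_derivative 0) (at z)" if z: "0 < z" "z < 1" for z
  proof -
    define c where "c = 1 - z * y"
    have c: "c > 0" using zy[of z] z by (simp add: c_def)
    have pos: "0 < ?u z" "0 < ?v z" "0 < 1 - ?u z" "0 < 1 - ?v z"
      unfolding u[OF less_imp_le[OF z(1)] less_imp_le[OF z(2)]] v[OF less_imp_le[OF z(1)] less_imp_le[OF z(2)]]
      using z y c by (simp_all flip: c_def)
    have bounds: "?u z < 1" "?v z < 1" "0 < z * y" "z * y < 1"
      using pos z y c by (simp_all only: c_def diff_gt_0_iff_gt mult_pos_pos)
    have lnu: "ln (?u z) = ln z + ln (1 - y) - ln c" "ln (1 - ?u z) = ln (1 - z) - ln c"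
      unfolding u[OF less_imp_le[OF z(1)] less_imp_le[OF z(2)]] using z y c by (simp_all add: ln_mult ln_div flip: c_def)
    have lnv: "ln (?v z) = ln y + ln (1 - z) - ln c" "ln (1 - ?v z) = ln (1 - y) - ln c"
      unfolding v[OF less_imp_le[OF z(1)] less_imp_le[OF z(2)]] using z y c by (simp_all add: ln_mult ln_div flip: c_def)
    have lnzy: "ln (z * y) = ln z + ln y" using z y by (simp add: ln_mult)
    have du: "(?u has_real_derivative (1 - y) / c ^ 2) (at z)"
      using c by (auto intro!: derivative_eq_intros simp: c_def power2_eq_square) (simp add: field_simps)
    have dv: "(?v has_real_derivative - y * (1 - y) / c ^ 2) (at z)"
    proof (rule DERIV_cong[OF DERIV_divide])
      show "((\<lambda>z. y * (1 - z)) has_real_derivative - y) (at z)"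
        "((\<lambda>z. 1 - z * y) has_real_derivative - y) (at z)"
        by (auto intro!: derivative_eq_intros)
      show "(- y * (1 - z * y) - y * (1 - z) * - y) / ((1 - z * y) * (1 - z * y)) = - y * (1 - y) / c ^ 2"
        by (rule arg_cong2[where f = "(/)"]) (simp_all add: c_def power2_eq_square algebra_simps)
    qed (use c in \<open>simp add: c_def\<close>)
    have dzy: "((\<lambda>z. z * y) has_real_derivative y) (at z)"
      by (auto intro!: derivative_eq_intros)
    have "(?h has_real_derivative
       - (ln (1 - z) / z + ln z / (1 - z)) / 2 + 0
       - (- (ln (1 - z * y) / (z * y) + ln (z * y) / (1 - z * y)) / 2 * y)
       - (- (ln (1 - ?u z) / ?u z + ln (?u z) / (1 - ?u z)) / 2 * ((1 - y) / c ^ 2))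
       - (- (ln (1 - ?v z) / ?v z + ln (?v z) / (1 - ?v z)) / 2 * (- y * (1 - y) / c ^ 2))) (at z)"
      by (rule DERIV_diff[OF DERIV_diff[OF DERIV_diff[OF DERIV_add[OF rogers_dilog_has_real_derivative[OF z]
            DERIV_const] DERIV_chain2[OF rogers_dilog_has_real_derivative[OF bounds(3,4)] dzy]]
            DERIV_chain2[OF rogers_dilog_has_real_derivative[OF pos(1) bounds(1)] du]]
            DERIV_chain2[OF rogers_dilog_has_real_derivative[OF pos(2) bounds(2)] dv]])
    moreover have "- (ln (1 - z) / z + ln z / (1 - z)) / 2 + 0
       - (- (ln (1 - z * y) / (z * y) + ln (z * y) / (1 - z * y)) / 2 * y)
       - (- (ln (1 - ?u z) / ?u z + ln (?u z) / (1 - ?u z)) / 2 * ((1 - y) / c ^ 2))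
       - (- (ln (1 - ?v z) / ?v z + ln (?v z) / (1 - ?v z)) / 2 * (- y * (1 - y) / c ^ 2)) = 0"
    proof -
      have su: "(1 - y) / c ^ 2 / ?u z = 1 / (z * c)"
        "(1 - y) / c ^ 2 / (1 - ?u z) = (1 - y) / ((1 - z) * c)"
        unfolding u[OF less_imp_le[OF z(1)] less_imp_le[OF z(2)]]
        using z y c by (simp_all add: power2_eq_square flip: c_def)
      have sv: "- y * (1 - y) / c ^ 2 / ?v z = - ((1 - y) / ((1 - z) * c))"
        "- y * (1 - y) / c ^ 2 / (1 - ?v z) = - (y / c)"
        unfolding v[OF less_imp_le[OF z(1)] less_imp_le[OF z(2)]] unfolding c_def[symmetric]
        using z y c by (simp_all add: power2_eq_square mult.commute)
      have szy: "y / (z * y) = 1 / z" using y by simp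
      have pf: "1 / (z * c) = 1 / z + y / c" "(1 - y) / ((1 - z) * c) = 1 / (1 - z) - y / c"
        using z c by (simp_all add: divide_simps) (simp_all add: c_def algebra_simps)
      have gen: "- (A / U + B / V) / 2 * W = - (A * (W / U) + B * (W / V)) / 2" for A B U V W :: real
        by (simp add: left_diff_distrib)
      \<comment> \<open>Here A, a, B, b, C stand for ln z, ln (1 - z), ln y, ln (1 - y), ln c, and
        z', w', t for 1/z, 1/(1 - z), y/c. After the partial fractions \<open>pf\<close> the
        derivative is linear in the logarithms, and the coefficient of each one cancels.\<close>
      have lin: "- (a / z + A / w) / 2 + 0 - - (C * z' + (A + B) * t) / 2
          - - ((a - C) * (z' + t) + (A + b - C) * (w' - t)) / 2
          - - ((b - C) * - (w' - t) + (B + a - C) * - t) / 2 = 0"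
        if "a / z = a * z'" "A / w = A * w'" for a z A w B b C t z' w' :: real
        unfolding that by (simp add: algebra_simps flip: add_divide_distrib)
      show ?thesis
        unfolding gen su sv lnu lnv lnzy unfolding szy pf c_def[symmetric] by (rule lin) simp_all
    qed
    ultimately show ?thesis by (simp only:)
  qed
  have "?h x = ?h 0"
    by (rule DERIV_isconst2[OF zero_less_one cont deriv]) (use x in simp_all)
  moreover have "?h 0 = 0" by simp
  ultimately show ?thesis by linarith
qed

section \<open>Two telescoping series with real parameters\<close>

lemma rogers_dilog_tendsto:
  assumes "(f \<longlongrightarrow> c) F" "0 \<le> c" "c \<le> 1" "eventually (\<lambda>x. f x \<in> {0..1}) F"
  shows "((\<lambda>x. rogers_dilog (f x)) \<longlongrightarrow> rogers_dilog c) F"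
  using continuous_on_tendsto_compose[OF continuous_on_rogers_dilog] assms by auto

text \<open>\<open>h k\<close> is L(x) + L(y) for the pair belonging to k. The bound k \<ge> 2 keeps
  both arguments below 1; at k = 1 they would equal 1.\<close>

lemma rogers_dilog_sinh_step:
  fixes r :: real and k :: nat
  assumes r: "r > 1" and k: "k \<ge> 2"
  defines "q \<equiv> 1 / r ^ 2"
  defines "h \<equiv> \<lambda>k. rogers_dilog ((1 - q) / (1 - q ^ k)) + rogers_dilog (q ^ (k - 1) * (1 - q) / (1 - q ^ k))"
  shows "rogers_dilog (((r - 1 / r) / (r ^ k - 1 / r ^ k)) ^ 2) = h k - h (Suc k)"
proof -
  have q: "0 < q" "q < 1" using r by (simp_all add: q_def)
  define p where "p = q ^ (k - 1)"
  have qk: "q ^ k = q * p" "q ^ Suc k = q * (q * p)"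
    using k by (cases k; simp add: p_def)+
  have p: "0 < p" "p < 1"
    using q k by (auto simp: p_def power_less_one_iff)
  have qp: "q * p < q" "q * p < 1" "q * (q * p) < 1"
  proof -
    show "q * p < q" using q p by simp
    with q show *: "q * p < 1" by linarith
    show "q * (q * p) < 1" using mult_strict_mono[OF q(2) *] q p by simp
  qed
  let ?x = "(1 - q) / (1 - q * p)" and ?y = "p * (1 - q) / (1 - q * p)"
  have x: "0 < ?x" "?x < 1" using q qp(1,2)
    by (simp_all only: divide_less_eq_1_pos diff_gt_0_iff_gt divide_pos_pos diff_strict_left_mono)
  have y: "0 < ?y" using q p qp by (intro divide_pos_pos mult_pos_pos) auto
  have "p * (1 - q) < 1 - q * p" using p by (simp add: right_diff_distrib mult.commute)
  then have y1: "?y < 1" using qp(2) by (simp only: divide_less_eq_1_pos diff_gt_0_iff_gt)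
  \<comment> \<open>The factor 1 - p also occurs in 1 - x and 1 - y and cancels, leaving 1 - q * (q
    * p), that is 1 - q^(k+1), as the denominator of both quotients.\<close>
  have 1: "1 - ?x * ?y = (1 - p) * (1 - q * (q * p)) / (1 - q * p) ^ 2"
    using qp(2) by (simp add: divide_simps) (simp add: algebra_simps power2_eq_square)
  have 2: "1 - ?x = q * (1 - p) / (1 - q * p)" "1 - ?y = (1 - p) / (1 - q * p)"
    using qp(2) by (simp_all add: field_simps)
  have 3: "?x * (1 - ?y) / (1 - ?x * ?y) = (1 - q) / (1 - q * (q * p))"
    unfolding 1 2 using q p qp by (simp add: divide_simps power2_eq_square)
  have 4: "?y * (1 - ?x) / (1 - ?x * ?y) = q * p * (1 - q) / (1 - q * (q * p))"
    unfolding 1 2 using q p qp by (simp add: divide_simps power2_eq_square)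
  have 5: "((r - 1 / r) / (r ^ k - 1 / r ^ k)) ^ 2 = ?x * ?y"
  proof -
    define s where "s = r ^ (k - 1)"
    have s: "s > 1" "r ^ k = r * s" "p = 1 / s ^ 2"
      using r k by (cases k;
        simp add: s_def p_def q_def power_divide one_less_power flip: power_mult; simp add: mult.commute)+
    have rs: "r * r * s * s > 1" "r * s > 1"
      using s r by (metis less_1_mult mult.assoc)+
    have e1: "r - 1 / r = r * (1 - q)" and e2: "r ^ k - 1 / r ^ k = r * s * (1 - q * p)"
      using r s by (simp_all add: q_def field_simps power2_eq_square)
    show ?thesis unfolding e1 e2 unfolding s using r s rs by (simp add: power2_eq_square)
  qed
  show ?thesis
    unfolding 5 h_def diff_Suc_1 qk p_def[symmetric]
    using rogers_dilog_five_term[OF x y y1, unfolded 3 4] by linarith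
qed

lemma rogers_dilog_sinh_series:
  fixes r :: real
  assumes r: "r > 1"
  shows "(\<lambda>j. rogers_dilog (((r - 1 / r) / (r ^ (j + 2) - 1 / r ^ (j + 2))) ^ 2)) sums rogers_dilog (1 / r ^ 2)"
proof -
  define q where "q = 1 / r ^ 2"
  have q: "0 < q" "q < 1" using r by (simp_all add: q_def)
  define h where "h = (\<lambda>k::nat. rogers_dilog ((1 - q) / (1 - q ^ k)) + rogers_dilog (q ^ (k - 1) * (1 - q) / (1 - q ^ k)))"
  have "(\<lambda>k. q ^ k) \<longlonglongrightarrow> 0" using q by (intro LIMSEQ_power_zero) auto
  then have p0: "(\<lambda>j. q ^ Suc j) \<longlonglongrightarrow> 0" "(\<lambda>j. q ^ (j + 2)) \<longlonglongrightarrow> 0"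
    by (rule LIMSEQ_Suc, rule LIMSEQ_ignore_initial_segment)
  have le: "q ^ (j + 2) \<le> q" "q ^ (j + 2) < 1" "q ^ Suc j \<le> 1" for j
    using q power_decreasing[of 1 "j + 2" q] by (auto simp: power_less_one_iff power_le_one simp del: power_Suc power_add)
  have "(\<lambda>j. rogers_dilog ((1 - q) / (1 - q ^ (j + 2)))) \<longlonglongrightarrow> rogers_dilog ((1 - q) / (1 - 0))"
    using q le by (intro rogers_dilog_tendsto tendsto_intros p0 always_eventually) (auto simp: divide_simps)
  moreover have "(\<lambda>j. rogers_dilog (q ^ Suc j * (1 - q) / (1 - q ^ (j + 2)))) \<longlonglongrightarrow> rogers_dilog (0 * (1 - q) / (1 - 0))"
  proof (intro rogers_dilog_tendsto tendsto_intros p0 always_eventually allI)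
    fix j
    have "q ^ Suc j * (1 - q) \<le> 1 * (1 - q ^ (j + 2))"
      using q le by (intro mult_mono) auto
    then show "q ^ Suc j * (1 - q) / (1 - q ^ (j + 2)) \<in> {0..1}"
      using q le[of j] by (auto simp: divide_le_eq simp del: power_Suc power_add intro!: divide_nonneg_pos mult_nonneg_nonneg)
  qed (use q in auto)
  ultimately have "(\<lambda>j. rogers_dilog ((1 - q) / (1 - q ^ (j + 2))) + rogers_dilog (q ^ Suc j * (1 - q) / (1 - q ^ (j + 2))))
    \<longlonglongrightarrow> rogers_dilog ((1 - q) / (1 - 0)) + rogers_dilog (0 * (1 - q) / (1 - 0))"
    by (rule tendsto_add)
  then have "(\<lambda>j. h (j + 2)) \<longlonglongrightarrow> rogers_dilog (1 - q)"
    by (simp add: h_def)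
  from telescope_sums'[OF this]
  have "(\<lambda>j. h (j + 2) - h (Suc (j + 2))) sums (h 2 - rogers_dilog (1 - q))"
    by (simp add: numeral_2_eq_2)
  \<comment> \<open>At k = 2 the factor 1 - q cancels and the arguments 1/(1+q) and q/(1+q) add up
    to 1, so \<open>h 2\<close> is L(1). A second reflection turns L(1) - L(1-q) into L(q).\<close>
  moreover have "h 2 - rogers_dilog (1 - q) = rogers_dilog q"
  proof -
    have f: "1 - q ^ 2 = (1 - q) * (1 + q)" by (simp add: algebra_simps power2_eq_square)
    have "h 2 = rogers_dilog (1 / (1 + q)) + rogers_dilog (q / (1 + q))"
      unfolding h_def f using q by simp
    moreover have "q / (1 + q) = 1 - 1 / (1 + q)" using q by (simp add: field_simps)
    ultimately show ?thesis
      using rogers_dilog_reflection[of "1 / (1 + q)"] rogers_dilog_reflection[of q] q by simp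
  qed
  ultimately show ?thesis
    using rogers_dilog_sinh_step[OF r, of "_ + 2"] by (simp only: h_def q_def le_add2)
qed

text \<open>With w = 1/t^2 the numerator of 1 - xy is the square of 1 + qw. One factor cancels
  against 1 - x or 1 - y, and the other becomes the denominator of the new arguments.\<close>

lemma rogers_dilog_cosh_step:
  fixes r t :: real
  assumes r: "r > 1" and t: "t > 0"
  defines "q \<equiv> 1 / r ^ 2"
  defines "g \<equiv> \<lambda>t. rogers_dilog ((1 - q) / (1 + t ^ 2)) - rogers_dilog ((1 - q) / (1 + q / t ^ 2))"
  shows "rogers_dilog ((r - 1 / r) ^ 2 / ((t + 1 / t) * (t * r ^ 2 + 1 / (t * r ^ 2)))) = g t - g (t * r)"
proof -
  have q: "0 < q" "q < 1" "r ^ 2 = 1 / q" using r by (simp_all add: q_def)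
  define w where "w = 1 / t ^ 2"
  have w: "w > 0" "t ^ 2 = 1 / w" using t by (simp_all add: w_def)
  have pos: "1 + w > 0" "1 + q * w > 0" "1 + q * (q * w) > 0" using w q by (simp_all add: add_pos_pos)
  let ?x = "w * (1 - q) / (1 + w)" and ?y = "(1 - q) / (1 + q * (q * w))"
  have x: "0 < ?x" "?x < 1" and y: "0 < ?y" "?y < 1"
    using w q pos by (simp_all add: divide_simps algebra_simps add_pos_pos)
  have 1: "1 - ?x * ?y = (1 + q * w) ^ 2 / ((1 + w) * (1 + q * (q * w)))"
    using pos by (simp add: divide_simps) (simp add: algebra_simps power2_eq_square)
  have 2: "1 - ?x = (1 + q * w) / (1 + w)" "1 - ?y = q * (1 + q * w) / (1 + q * (q * w))"
    using pos by (simp_all add: divide_simps) (simp_all add: algebra_simps)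
  have 3: "?x * (1 - ?y) / (1 - ?x * ?y) = q * w * (1 - q) / (1 + q * w)"
    unfolding 1 2 using pos by (simp add: divide_simps power2_eq_square)
  have 4: "?y * (1 - ?x) / (1 - ?x * ?y) = (1 - q) / (1 + q * w)"
    unfolding 1 2 using pos by (simp add: divide_simps power2_eq_square)
  have 5: "(r - 1 / r) ^ 2 / ((t + 1 / t) * (t * r ^ 2 + 1 / (t * r ^ 2))) = ?x * ?y"
  proof -
    have e: "r - 1 / r = r * (1 - q)" "t + 1 / t = t * (1 + w)"
      "t * r ^ 2 + 1 / (t * r ^ 2) = t * r ^ 2 * (1 + q * (q * w))"
      using r t by (simp_all add: q_def w_def field_simps power2_eq_square)
    have "(r * (1 - q)) ^ 2 / (t * (1 + w) * (t * r ^ 2 * (1 + q * (q * w))))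
        = (1 - q) ^ 2 / (t ^ 2 * (1 + w) * (1 + q * (q * w)))"
      using r by (simp add: power2_eq_square)
    also have "\<dots> = ?x * ?y" unfolding w(2) using w(1) by (simp add: power2_eq_square)
    finally show ?thesis unfolding e .
  qed
  \<comment> \<open>The first and third arguments make up g(t), the second and fourth g(tr). In the
    five-term relation x and y stand on one side and the two quotients on the other, hence the minus
    sign inside \<open>g\<close>.\<close>
  have 6: "(1 - q) / (1 + t ^ 2) = ?x" "(1 - q) / (1 + (t * r) ^ 2) = q * w * (1 - q) / (1 + q * w)"
    "(1 - q) / (1 + q / t ^ 2) = (1 - q) / (1 + q * w)" "(1 - q) / (1 + q / (t * r) ^ 2) = ?y"
    unfolding power_mult_distrib q(3) w(2) using w(1) q(1) pos by (simp_all add: field_simps)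
  show ?thesis
    unfolding 5 g_def 6 using rogers_dilog_five_term[OF x y, unfolded 3 4] by simp
qed

text \<open>As t r^j grows, g(t r^j) tends to L(0) - L(1-q), so the telescoped sum is g(t) +
  L(1-q).\<close>

lemma rogers_dilog_cosh_series:
  fixes r t :: real
  assumes r: "r > 1" and t: "t > 0"
  defines "q \<equiv> 1 / r ^ 2"
  shows "(\<lambda>j. rogers_dilog ((r - 1 / r) ^ 2 /
      ((t * r ^ j + 1 / (t * r ^ j)) * (t * r ^ (j + 2) + 1 / (t * r ^ (j + 2))))))
    sums (rogers_dilog ((1 - q) / (1 + t ^ 2)) - rogers_dilog ((1 - q) / (1 + q / t ^ 2)) + rogers_dilog (1 - q))"
proof -
  have q: "0 < q" "q < 1" using r by (simp_all add: q_def)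
  define g where "g = (\<lambda>t. rogers_dilog ((1 - q) / (1 + t ^ 2)) - rogers_dilog ((1 - q) / (1 + q / t ^ 2)))"
  have bounds: "(1 - q) / (1 + a) \<in> {0..1}" if "a \<ge> 0" for a
    using that q by (auto simp: divide_simps)
  have "(\<lambda>j. rogers_dilog ((1 - q) / (1 + (t * r ^ j) ^ 2))) \<longlonglongrightarrow> rogers_dilog 0"
  proof (intro rogers_dilog_tendsto always_eventually allI bounds)
    show "(\<lambda>j. (1 - q) / (1 + (t * r ^ j) ^ 2)) \<longlonglongrightarrow> 0"
      using r t by real_asymp
  qed auto
  moreover have "(\<lambda>j. rogers_dilog ((1 - q) / (1 + q / (t * r ^ j) ^ 2))) \<longlonglongrightarrow> rogers_dilog (1 - q)"
  proof (intro rogers_dilog_tendsto always_eventually allI bounds)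
    show "(\<lambda>j. (1 - q) / (1 + q / (t * r ^ j) ^ 2)) \<longlonglongrightarrow> 1 - q"
      using r t by real_asymp
  qed (use q in auto)
  ultimately have "(\<lambda>j. g (t * r ^ j)) \<longlonglongrightarrow> rogers_dilog 0 - rogers_dilog (1 - q)"
    unfolding g_def by (rule tendsto_diff)
  from telescope_sums'[OF this]
  have "(\<lambda>j. g (t * r ^ j) - g (t * r ^ j * r)) sums (g t + rogers_dilog (1 - q))"
    by (simp add: mult.assoc mult.commute[of r])
  moreover have "g (t * r ^ j) - g (t * r ^ j * r) = rogers_dilog ((r - 1 / r) ^ 2 /
      ((t * r ^ j + 1 / (t * r ^ j)) * (t * r ^ (j + 2) + 1 / (t * r ^ (j + 2)))))" for j
    unfolding g_def q_def power_add mult.assoc[symmetric]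
    by (rule rogers_dilog_cosh_step[symmetric]) (use r t in auto)
  ultimately show ?thesis by (simp only: g_def)
qed

section \<open>The golden ratio and Binet formulas over the integers\<close>

lemma golden_ratio_gt_1: "golden_ratio > 1"
  and golden_ratio_square: "golden_ratio ^ 2 = golden_ratio + 1"
  by (simp_all add: golden_ratio_def power2_eq_square field_simps)

lemma rogers_dilog_golden_ratio: "rogers_dilog (1 / golden_ratio) = pi ^ 2 / 10"
proof -
  define u where "u = 1 / golden_ratio"
  have u: "0 < u" "u < 1" "u * u = 1 - u"
    using golden_ratio_gt_1 golden_ratio_square by (simp_all add: u_def field_simps power2_eq_square)
  \<comment> \<open>Since u^2 = 1 - u, all three arguments on the right are 1 - u, so 2 L(u) = 3
    L(1-u). Reflection then gives L(u) = (3/5) (pi^2/6).\<close>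
  have 1: "u * (1 - u) / (1 - u * u) = 1 - u" using u by simp
  show ?thesis
    using rogers_dilog_five_term[OF u(1,2,1,2)] rogers_dilog_reflection[of u] u(1,2)
    unfolding 1 u(3) by (simp add: u_def)
qed

text \<open>Two consecutive values determine the neighbours on both sides, so induction on such
  pairs runs upwards and downwards from 0.\<close>

lemma fib_recurrence_unique:
  fixes g h :: "int \<Rightarrow> real"
  assumes "\<And>n. g n = g (n - 1) + g (n - 2)" "\<And>n. h n = h (n - 1) + h (n - 2)"
    and "g 0 = h 0" "g 1 = h 1"
  shows "g n = h n"
proof -
  have "g n = h n \<and> g (n + 1) = h (n + 1)"
  proof (induction n rule: int_induct[where k = 0])
    case (step1 i)
    then show ?case using assms(1)[of "i + 2"] assms(2)[of "i + 2"] by (simp add: algebra_simps)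
  next
    case (step2 i)
    then show ?case using assms(1)[of "i + 1"] assms(2)[of "i + 1"] by (simp add: algebra_simps)
  qed (use assms(3,4) in auto)
  then show ?thesis ..
qed

lemma power_int_fib_recurrence:
  fixes x :: real
  assumes "x ^ 2 = x + 1"
  shows "x powi n = x powi (n - 1) + x powi (n - 2)"
proof -
  have "x \<noteq> 0" using assms by auto
  then have "x powi n = x powi (n - 2) * x ^ 2" "x powi (n - 1) = x powi (n - 2) * x"
    using power_int_add[of x "n - 2" 2] power_int_add[of x "n - 2" 1] by simp_all
  then show ?thesis by (simp add: assms algebra_simps)
qed

text \<open>The second root of x^2 = x + 1, written as a negated reciprocal so that its powers are
  signed reciprocals of powers of the golden ratio.\<close>

definition golden_conj :: real where "golden_conj = - (1 / golden_ratio)"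

lemma golden_conj_eq: "golden_conj = 1 - golden_ratio"
  using golden_ratio_gt_1 golden_ratio_square by (simp add: golden_conj_def field_simps power2_eq_square)

lemma golden_conj_square: "golden_conj ^ 2 = golden_conj + 1"
  using golden_ratio_square by (simp add: golden_conj_eq power2_eq_square algebra_simps)

lemma golden_conj_power_int:
  "golden_conj powi n = (if even n then 1 / golden_ratio powi n else - (1 / golden_ratio powi n))"
  by (simp add: golden_conj_def power_int_minus_left power_int_one_over)

lemma binet_fibz: "sqrt 5 * fibz n = golden_ratio powi n - golden_conj powi n"
proof (rule fib_recurrence_unique)
  show "sqrt 5 * fibz n = sqrt 5 * fibz (n - 1) + sqrt 5 * fibz (n - 2)" for n
    by (subst fibz_rec) (simp add: algebra_simps)
  show "golden_ratio powi n - golden_conj powi n = golden_ratio powi (n - 1) - golden_conj powi (n - 1)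
      + (golden_ratio powi (n - 2) - golden_conj powi (n - 2))" for n
    using power_int_fib_recurrence[OF golden_ratio_square, of n]
      power_int_fib_recurrence[OF golden_conj_square, of n] by simp
qed (simp_all add: golden_conj_eq, simp add: golden_ratio_def field_simps)

lemma binet_lucasz: "lucasz n = golden_ratio powi n + golden_conj powi n"
proof (rule fib_recurrence_unique)
  show "real_of_int (lucasz n) = real_of_int (lucasz (n - 1)) + real_of_int (lucasz (n - 2))" for n
    by (subst lucasz_rec) simp
  show "golden_ratio powi n + golden_conj powi n = golden_ratio powi (n - 1) + golden_conj powi (n - 1)
      + (golden_ratio powi (n - 2) + golden_conj powi (n - 2))" for n
    using power_int_fib_recurrence[OF golden_ratio_square, of n]
      power_int_fib_recurrence[OF golden_conj_square, of n] by simp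
qed (simp_all add: golden_conj_eq)

text \<open>Twice the hyperbolic sine of n ln phi; \<open>gr_cosh\<close> is the corresponding
  cosine. Neither formula depends on the parity of n, so each series is treated once for all
  exponents.\<close>

definition gr_sinh :: "int \<Rightarrow> real" where
  "gr_sinh n = golden_ratio powi n - 1 / golden_ratio powi n"

definition gr_cosh :: "int \<Rightarrow> real" where
  "gr_cosh n = golden_ratio powi n + 1 / golden_ratio powi n"

text \<open>Parity fixes the sign of the conjugate power and thereby which Binet formula carries the
  minus sign.\<close>

lemma gr_sinh_even: "even n \<Longrightarrow> gr_sinh n = sqrt 5 * fibz n"
  and gr_sinh_odd: "odd n \<Longrightarrow> gr_sinh n = lucasz n"
  and gr_cosh_even: "even n \<Longrightarrow> gr_cosh n = lucasz n"
  and gr_cosh_odd: "odd n \<Longrightarrow> gr_cosh n = sqrt 5 * fibz n"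
  by (simp_all add: gr_sinh_def gr_cosh_def binet_fibz binet_lucasz golden_conj_power_int)

section \<open>The series at integer powers of the golden ratio\<close>

lemma golden_ratio_power_int_gt_1: "m > 0 \<Longrightarrow> golden_ratio powi m > 1"
  using golden_ratio_gt_1 by (simp add: power_int_def one_less_power)

lemma gr_sinh_series:
  assumes "m > 0"
  shows "(\<lambda>j. rogers_dilog ((gr_sinh m / gr_sinh (m * int (j + 2))) ^ 2)) sums
    rogers_dilog (1 / golden_ratio powi (2 * m))"
proof -
  have "golden_ratio powi (m * int k) = (golden_ratio powi m) ^ k" for k
    by (simp add: power_int_mult power_int_of_nat)
  moreover have "golden_ratio powi (2 * m) = (golden_ratio powi m) ^ 2"
    by (metis mult.commute power_int_mult power_int_numeral)
  ultimately show ?thesis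
    using rogers_dilog_sinh_series[OF golden_ratio_power_int_gt_1[OF assms]] by (simp only: gr_sinh_def)
qed

lemma gr_sinh_mono: "a \<le> b \<Longrightarrow> gr_sinh a \<le> gr_sinh b"
  unfolding gr_sinh_def using golden_ratio_gt_1
  by (intro diff_mono divide_left_mono power_int_increasing mult_pos_pos) auto

lemma gr_sinh_pos: "m > 0 \<Longrightarrow> gr_sinh m > 0"
  using golden_ratio_power_int_gt_1[of m] by (simp add: gr_sinh_def field_simps) (simp add: less_1_mult)

text \<open>Nonnegative terms make every subseries along an injection summable, and grouping
  consecutive pairs identifies the sum of the two parts.\<close>

lemma sums_split_parity:
  fixes a :: "nat \<Rightarrow> real"
  assumes "a sums s" "\<And>n. a n \<ge> 0"
  shows "\<exists>A B. (\<lambda>j. a (2 * j + 1)) sums A \<and> (\<lambda>j. a (2 * j)) sums B \<and> A + B = s"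
proof -
  have s: "summable (\<lambda>j. a (g j))" if "inj g" for g :: "nat \<Rightarrow> nat"
    using summable_reindex[OF _ that, of a] assms by (simp add: sums_iff o_def)
  have ev: "summable (\<lambda>j. a (2 * j))" and od: "summable (\<lambda>j. a (2 * j + 1))"
    by (rule s, simp add: inj_def)+
  have "(\<lambda>n. sum a {n * 2..<n * 2 + 2}) sums s" by (rule sums_group[OF assms(1)]) simp
  moreover have "sum a {n * 2..<n * 2 + 2} = a (2 * n + 1) + a (2 * n)" for n
    by (simp add: numeral_2_eq_2 add.commute mult.commute)
  ultimately have "(\<lambda>j. a (2 * j + 1) + a (2 * j)) sums s" by simp
  moreover have "(\<lambda>j. a (2 * j + 1) + a (2 * j)) sums (suminf (\<lambda>j. a (2 * j + 1)) + suminf (\<lambda>j. a (2 * j)))"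
    by (intro sums_add summable_sums ev od)
  ultimately show ?thesis
    using sums_unique2 summable_sums[OF ev] summable_sums[OF od] by blast
qed

text \<open>The multiples of m from 2m on are separated into odd and even ones. For odd m these
  yield Lucas and Fibonacci numbers respectively, as (d) requires.\<close>

lemma gr_sinh_series_parity:
  assumes "m > 0"
  shows "\<exists>A B. (\<lambda>j. rogers_dilog ((gr_sinh m / gr_sinh (m * (2 * int j + 3))) ^ 2)) sums A
    \<and> (\<lambda>j. rogers_dilog ((gr_sinh m / gr_sinh (m * (2 * int j + 2))) ^ 2)) sums B
    \<and> A + B = rogers_dilog (1 / golden_ratio powi (2 * m))"
proof -
  have "rogers_dilog ((gr_sinh m / gr_sinh (m * int (j + 2))) ^ 2) \<ge> 0" for j
  proof (rule rogers_dilog_nonneg)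
    have "gr_sinh m \<le> gr_sinh (m * int (j + 2))"
      using assms by (intro gr_sinh_mono) (simp add: algebra_simps)
    then show "(gr_sinh m / gr_sinh (m * int (j + 2))) ^ 2 \<le> 1"
      using gr_sinh_pos[OF assms] by (intro power_le_one) (auto simp: divide_simps)
  qed simp
  moreover have "int (2 * j + 1 + 2) = 2 * int j + 3" "int (2 * j + 2) = 2 * int j + 2" for j
    by simp_all
  ultimately show ?thesis
    using sums_split_parity[OF gr_sinh_series[OF assms]] by (simp only:)
qed

lemma gr_cosh_series:
  assumes "m > 0"
  shows "(\<lambda>j. rogers_dilog (gr_sinh m ^ 2 / (gr_cosh (b + m * int j) * gr_cosh (b + m * int (j + 2))))) sums
    (rogers_dilog ((1 - 1 / golden_ratio powi (2 * m)) / (1 + golden_ratio powi (2 * b)))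
      - rogers_dilog ((1 - 1 / golden_ratio powi (2 * m)) / (1 + 1 / golden_ratio powi (2 * m + 2 * b)))
      + rogers_dilog (1 - 1 / golden_ratio powi (2 * m)))"
proof -
  have nz: "golden_ratio \<noteq> 0" using golden_ratio_gt_1 by simp
  have sq: "golden_ratio powi (2 * k) = (golden_ratio powi k) ^ 2" for k
    by (metis mult.commute power_int_mult power_int_numeral)
  have 1: "golden_ratio powi (b + m * int k) = golden_ratio powi b * (golden_ratio powi m) ^ k" for k
    using nz by (simp add: power_int_mult power_int_of_nat power_int_add)
  have 2: "1 / golden_ratio powi (2 * m + 2 * b) = 1 / (golden_ratio powi m) ^ 2 / (golden_ratio powi b) ^ 2"
    using nz by (simp add: power_int_add sq)
  have "golden_ratio powi b > 0" using golden_ratio_gt_1 by simp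
  from rogers_dilog_cosh_series[OF golden_ratio_power_int_gt_1[OF assms] this] show ?thesis
    unfolding gr_sinh_def gr_cosh_def 1 2 unfolding sq .
qed

text \<open>The condition on b says t^2 = q/t^2 for t = phi^b and q = 1/phi^(2m), so both terms of
  g(t) coincide and only L(1-q) remains.\<close>

lemma gr_cosh_series_symmetric:
  assumes "m > 0" "m = - 2 * b"
  shows "(\<lambda>j. rogers_dilog (gr_sinh m ^ 2 / (gr_cosh (b + m * int j) * gr_cosh (b + m * int (j + 2))))) sums
    rogers_dilog (1 - 1 / golden_ratio powi (2 * m))"
proof -
  have "1 / golden_ratio powi (2 * m + 2 * b) = golden_ratio powi (2 * b)"
    by (simp add: assms(2) power_int_minus_divide)
  with gr_cosh_series[OF assms(1), of b] show ?thesis by simp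
qed

lemma gr_sinh_2: "gr_sinh 2 = sqrt 5" and gr_sinh_4: "gr_sinh 4 = 3 * sqrt 5" and gr_sinh_1: "gr_sinh 1 = 1"
proof -
  have "fibz 2 = 1" using fibz_rec[of 2] by simp
  moreover have "fibz 3 = fibz 2 + fibz 1" using fibz_rec[of 3] by simp
  moreover have "fibz 4 = fibz 3 + fibz 2" using fibz_rec[of 4] by simp
  ultimately show "gr_sinh 2 = sqrt 5" "gr_sinh 4 = 3 * sqrt 5" by (simp_all add: gr_sinh_even)
  show "gr_sinh 1 = 1" by (simp add: gr_sinh_odd)
qed

text \<open>The series with increments \<open>m = 1\<close> and \<open>b = -1\<close> is half of a bilateral series that is
  symmetric about its initial term, which therefore has to be counted with weight \<open>1/2\<close>.\<close>
lemma gr_cosh_series_half: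
  "(\<lambda>j. (if j = 0 then 1 / 2 else 1) * rogers_dilog (1 / (gr_cosh (int j - 1) * gr_cosh (int j + 1)))) sums
    rogers_dilog (1 / golden_ratio)"
proof -
  let ?a = "\<lambda>j. rogers_dilog (1 / (gr_cosh (int j - 1) * gr_cosh (int j + 1)))"
  define q where "q = 1 / golden_ratio powi 2"
  let ?X = "rogers_dilog ((1 - q) / (1 + q))" and ?Y = "rogers_dilog ((1 - q) / 2)"
  have q: "1 - q = 1 / golden_ratio"
    using golden_ratio_gt_1 golden_ratio_square by (simp add: q_def field_simps power2_eq_square)
  have "golden_ratio powi - 2 = q" by (simp add: q_def power_int_minus_divide)
  then have s: "?a sums (?X - ?Y + rogers_dilog (1 - q))"
    using gr_cosh_series[of 1 "-1"] by (simp add: gr_sinh_1 q_def algebra_simps)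
  have s': "(\<lambda>j. ?a (Suc j)) sums (?Y - ?X + rogers_dilog (1 - q))"
    using gr_cosh_series[of 1 0] by (simp add: gr_sinh_1 q_def algebra_simps)
  \<comment> \<open>Starting at b = 0 instead of b = -1 drops the first term and swaps the boundary
    values \<open>?X\<close> and \<open>?Y\<close>. Comparing the two sums determines that term, and
    removing half of it cancels the boundary contribution.\<close>
  have a0: "?a 0 = 2 * (?X - ?Y)"
    using sums_unique2[OF sums_Suc[OF s'] s] by simp
  have "(\<lambda>j. ?a j - (if j = 0 then ?a 0 / 2 else 0)) sums (?X - ?Y + rogers_dilog (1 - q) - ?a 0 / 2)"
    by (intro sums_diff s sums_single)
  moreover have "?a j - (if j = 0 then ?a 0 / 2 else 0) = (if j = 0 then 1 / 2 else 1) * ?a j" for j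
    by simp
  moreover have "x - y + z - w / 2 = z" if "w = 2 * (x - y)" for x y z w :: real
    using that by (simp add: field_simps)
  note this[OF a0, of "rogers_dilog (1 - q)"]
  ultimately show ?thesis by (simp only: q)
qed

section \<open>Specialisation to the Fibonacci and Lucas identities (a) to (f)\<close>

theorem theorem1p1:
  fixes L :: "real \<Rightarrow> real" and f l :: "int \<Rightarrow> real" and \<phi> :: real
    and \<epsilon> :: "int \<Rightarrow> real"
  defines "L \<equiv> rogers_dilog"
    and "f \<equiv> (\<lambda>k. real_of_int (fibz k))"
    and "l \<equiv> (\<lambda>k. real_of_int (lucasz k))"
    and "\<phi> \<equiv> golden_ratio"
  assumes eps1: "\<epsilon> 1 = 1 / 2" and eps2: "\<And>k. k \<ge> 2 \<Longrightarrow> \<epsilon> k = 1"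
  shows
    \<comment> \<open>(a)\<close>
    "(\<forall>n::int. n \<ge> 1 \<longrightarrow>
       sums_from (\<lambda>k. L ((f (2*n) / f (2*n*k)) ^ 2)) 2 (L ((1 / \<phi>) powi (4*n))))
     \<and> \<comment> \<open>(b)\<close>
     (sums_from (\<lambda>k. L ((1 / f (2*k)) ^ 2)) 2 (L (1 / \<phi> ^ 4))
      \<and> sums_from (\<lambda>k. L (1 / (f (2*k-3) * f (2*k+1)))) 1 (L (1 - 1 / \<phi> ^ 4))
      \<and> sums_from (\<lambda>k. L (1 / f (2*k+2) ^ 2) + L (1 / (f (2*k-3) * f (2*k+1)))) 1 (pi ^ 2 / 6))
     \<and> \<comment> \<open>(c)\<close>
     (sums_from (\<lambda>k. L (3 ^ 2 / f (4*k) ^ 2)) 2 (L (1 / \<phi> ^ 8))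
      \<and> sums_from (\<lambda>k. L (45 / (l (4*k-2) * l (4*k+6)))) 0 (L (1 - 1 / \<phi> ^ 8))
      \<and> (\<exists>A B. sums_from (\<lambda>k. L (3 ^ 2 / f (4*k) ^ 2)) 2 A
             \<and> sums_from (\<lambda>k. L (45 / (l (4*k-2) * l (4*k+6)))) 0 B
             \<and> A + B = pi ^ 2 / 6))
     \<and> \<comment> \<open>(d)\<close>
     (\<forall>n::int. n \<ge> 0 \<longrightarrow>
       (\<exists>A B. sums_from (\<lambda>k. L (l (2*n+1) ^ 2 / l (k*(4*n+2) - (2*n+1)) ^ 2)) 2 A
            \<and> sums_from (\<lambda>k. L (l (2*n+1) ^ 2 / (5 * f (k*(4*n+2)) ^ 2))) 1 B
            \<and> A + B = L (1 / \<phi> powi (4*n+2))))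
     \<and> \<comment> \<open>(e)\<close>
     sums_from (\<lambda>k. L (1 / (5 * f (2*k) ^ 2)) + L (1 / l (2*k+1) ^ 2)
                  + L (1 / (l (2*k-2) * l (2*k)))
                  + \<epsilon> k * L (1 / (5 * f (2*k-3) * f (2*k-1)))) 1 (pi ^ 2 / 6)
     \<and> \<comment> \<open>(f)\<close>
     (sums_from (\<lambda>k. L (1 / (l (2*k-2) * l (2*k)))
                   + \<epsilon> k * L (1 / (5 * f (2*k-3) * f (2*k-1)))) 1 (L (1 / \<phi>))
      \<and> L (1 / \<phi>) = pi ^ 2 / 10)"
proof -
  have L: "L = rogers_dilog" and f: "f = (\<lambda>k. real_of_int (fibz k))" and l: "l = (\<lambda>k. real_of_int (lucasz k))"
    and \<phi>: "\<phi> = golden_ratio"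
    by (simp_all add: L_def f_def l_def \<phi>_def)
  have sinh: "odd n \<Longrightarrow> l n = gr_sinh n" "even n \<Longrightarrow> f n = gr_sinh n / sqrt 5" for n
    by (simp_all add: f l gr_sinh_even gr_sinh_odd)
  have cosh: "even n \<Longrightarrow> l n = gr_cosh n" "odd n \<Longrightarrow> f n = gr_cosh n / sqrt 5" for n
    by (simp_all add: f l gr_cosh_even gr_cosh_odd)
  have pow: "golden_ratio powi numeral k = golden_ratio ^ numeral k" for k
    by (rule power_int_numeral)
  have \<phi>_gt_1: "\<phi> > 1" by (simp add: \<phi> golden_ratio_gt_1)
  have reflect: "L (1 / \<phi> ^ k) + L (1 - 1 / \<phi> ^ k) = pi ^ 2 / 6" for k
    unfolding L using \<phi>_gt_1 by (intro rogers_dilog_reflection) (simp_all add: one_le_power)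

  have a: "sums_from (\<lambda>k. L ((f (2*n) / f (2*n*k)) ^ 2)) 2 (L ((1 / \<phi>) powi (4*n)))" if "n \<ge> 1" for n
  proof -
    have "(1 / \<phi>) powi (4 * n) = 1 / golden_ratio powi (2 * (2 * n))"
      by (simp add: \<phi> power_int_one_over)
    moreover have "2 * n > 0" using that by simp
    ultimately show ?thesis
      using gr_sinh_series[of "2 * n"] by (simp add: sums_from_def L sinh algebra_simps)
  qed
  have f2: "f 2 = 1" and f4: "f 4 = 3"
    by (simp_all add: sinh gr_sinh_2 gr_sinh_4)

  have b1: "sums_from (\<lambda>k. L ((1 / f (2*k)) ^ 2)) 2 (L (1 / \<phi> ^ 4))"
    using a[of 1] by (simp add: f2 power_int_one_over power_divide \<phi> pow)
  have b2: "sums_from (\<lambda>k. L (1 / (f (2*k-3) * f (2*k+1)))) 1 (L (1 - 1 / \<phi> ^ 4))"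
  proof -
    \<comment> \<open>This is m = 2, b = -1. All indices are odd, and the two factors sqrt 5 in
      Binet's formula produce 5 = \<open>gr_sinh 2 ^ 2\<close>.\<close>
    have "1 / (f (2 * (1 + int j) - 3) * f (2 * (1 + int j) + 1)) =
        gr_sinh 2 ^ 2 / (gr_cosh (- 1 + 2 * int j) * gr_cosh (- 1 + 2 * int (j + 2)))" for j
      by (simp add: cosh gr_sinh_2 algebra_simps)
    then show ?thesis
      using gr_cosh_series_symmetric[of 2 "-1"] by (simp add: sums_from_def L \<phi> pow)
  qed
  have b3: "sums_from (\<lambda>k. L (1 / f (2*k+2) ^ 2) + L (1 / (f (2*k-3) * f (2*k+1)))) 1 (pi ^ 2 / 6)"
    using sums_add[OF b1[unfolded sums_from_def] b2[unfolded sums_from_def]]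
    unfolding reflect sums_from_def by (simp add: power_divide algebra_simps)

  have c1: "sums_from (\<lambda>k. L (3 ^ 2 / f (4*k) ^ 2)) 2 (L (1 / \<phi> ^ 8))"
    using a[of 2] by (simp add: f4 power_int_one_over power_divide \<phi> pow)
  have c2: "sums_from (\<lambda>k. L (45 / (l (4*k-2) * l (4*k+6)))) 0 (L (1 - 1 / \<phi> ^ 8))"
  proof -
    have "(\<lambda>j. rogers_dilog (gr_sinh 4 ^ 2 / (gr_cosh (- 2 + 4 * int j) * gr_cosh (- 2 + 4 * int (j + 2)))))
        sums rogers_dilog (1 - 1 / golden_ratio ^ 8)"
    proof -
      have "golden_ratio powi (2 * 4) = golden_ratio ^ 8" by (simp add: pow)
      note gr_cosh_series_symmetric[of 4 "-2", unfolded this]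
      then show ?thesis by this simp_all
    qed
    \<comment> \<open>The constant 45 is the square of \<open>gr_sinh 4\<close>, which is 3 sqrt 5;
      the even indices give Lucas numbers without further factors.\<close>
    moreover have "gr_sinh 4 ^ 2 / (gr_cosh (- 2 + 4 * int j) * gr_cosh (- 2 + 4 * int (j + 2))) =
        45 / (l (4 * (0 + int j) - 2) * l (4 * (0 + int j) + 6))" for j
      by (simp add: cosh gr_sinh_4 algebra_simps power_mult_distrib)
    ultimately show ?thesis
      by (simp only: sums_from_def L \<phi>)
  qed

  have d: "\<exists>A B. sums_from (\<lambda>k. L (l (2*n+1) ^ 2 / l (k*(4*n+2) - (2*n+1)) ^ 2)) 2 A
            \<and> sums_from (\<lambda>k. L (l (2*n+1) ^ 2 / (5 * f (k*(4*n+2)) ^ 2))) 1 B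
            \<and> A + B = L (1 / \<phi> powi (4*n+2))" if "n \<ge> 0" for n
  proof -
    \<comment> \<open>With k = 2 + j the Lucas index is m(2j+3), and with k = 1 + j the Fibonacci
      index is m(2j+2). The Lucas series starts at k = 2 because k = 1 would be the omitted multiple
      m itself.\<close>
    define m where "m = 2 * n + 1"
    have m: "m > 0" "odd m" "4 * n + 2 = 2 * m" using that by (simp_all add: m_def)
    have "l m ^ 2 / l ((2 + int j) * (2 * m) - m) ^ 2 = (gr_sinh m / gr_sinh (m * (2 * int j + 3))) ^ 2" for j
    proof -
      have eq: "(2 + int j) * (2 * m) - m = m * (2 * int j + 3)" by (simp add: algebra_simps)
      show ?thesis unfolding eq using m(2) by (simp add: sinh power_divide)
    qed
    moreover have "l m ^ 2 / (5 * f ((1 + int j) * (2 * m)) ^ 2) = (gr_sinh m / gr_sinh (m * (2 * int j + 2))) ^ 2" for j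
    proof -
      have eq: "(1 + int j) * (2 * m) = m * (2 * int j + 2)" by (simp add: algebra_simps)
      show ?thesis unfolding eq using m(2) by (simp add: sinh power_divide)
    qed
    ultimately show ?thesis
      using gr_sinh_series_parity[OF m(1)] unfolding m(3) m_def[symmetric] sums_from_def L \<phi> by simp
  qed

  have f_part: "sums_from (\<lambda>k. L (1 / (l (2*k-2) * l (2*k)))
                   + \<epsilon> k * L (1 / (5 * f (2*k-3) * f (2*k-1)))) 1 (L (1 / \<phi>))"
  proof -
    let ?a = "\<lambda>j. (if j = 0 then 1 / 2 else 1) * rogers_dilog (1 / (gr_cosh (int j - 1) * gr_cosh (int j + 1)))"
    \<comment> \<open>Terms are paired: index 2j gives the odd-index Fibonacci product, index 2j + 1
      the Lucas product. The halved initial term becomes the weight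
      \<open>\<epsilon> 1\<close>.\<close>
    have "sum ?a {j * 2..<j * 2 + 2} = L (1 / (l (2 * (1 + int j) - 2) * l (2 * (1 + int j))))
        + \<epsilon> (1 + int j) * L (1 / (5 * f (2 * (1 + int j) - 3) * f (2 * (1 + int j) - 1)))" for j
    proof -
      have "sum ?a {j * 2..<j * 2 + 2} = ?a (2 * j + 1) + ?a (2 * j)"
        by (simp add: numeral_2_eq_2 add.commute mult.commute)
      moreover have "?a (2 * j + 1) = L (1 / (l (2 * (1 + int j) - 2) * l (2 * (1 + int j))))"
        by (simp add: cosh L algebra_simps)
      moreover have "(if 2 * j = 0 then 1 / 2 else 1) = \<epsilon> (1 + int j)"
        using eps1 eps2[of "1 + int j"] by simp
      moreover have "1 / (gr_cosh (int (2 * j) - 1) * gr_cosh (int (2 * j) + 1)) =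
          1 / (5 * f (2 * (1 + int j) - 3) * f (2 * (1 + int j) - 1))"
        by (simp add: cosh algebra_simps)
      ultimately show ?thesis by (simp only: L)
    qed
    with sums_group[OF gr_cosh_series_half, of 2] show ?thesis
      by (simp only: sums_from_def L \<phi>)
  qed

  have e: "sums_from (\<lambda>k. L (1 / (5 * f (2*k) ^ 2)) + L (1 / l (2*k+1) ^ 2)
                  + L (1 / (l (2*k-2) * l (2*k)))
                  + \<epsilon> k * L (1 / (5 * f (2*k-3) * f (2*k-1)))) 1 (pi ^ 2 / 6)"
  proof -
    \<comment> \<open>Case n = 0 of (d) supplies L(1/phi^2), which is L(1 - 1/phi) and complements
      the value in (f). The Lucas sum from k = 2 over l(2k-1) is the sum from k = 1 over
      l(2k+1).\<close>
    obtain A B where A: "sums_from (\<lambda>k. L (1 / l (k*2-1) ^ 2)) 2 A"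
      and B: "sums_from (\<lambda>k. L (1 / (5 * f (k*2) ^ 2))) 1 B" and AB: "A + B = L (1 / \<phi> ^ 2)"
      using d[of 0] by (auto simp: l \<phi> pow)
    have "1 / \<phi> ^ 2 = 1 - 1 / \<phi> ^ 1"
      using \<phi>_gt_1 golden_ratio_square by (simp add: \<phi> field_simps power2_eq_square)
    then have sum: "B + A + L (1 / \<phi>) = pi ^ 2 / 6"
      using reflect[of 1] AB by simp
    show ?thesis
      using sums_add[OF sums_add[OF B[unfolded sums_from_def] A[unfolded sums_from_def]] f_part[unfolded sums_from_def]]
      unfolding sum sums_from_def by (simp add: algebra_simps)
  qed
  \<comment> \<open>The witnesses for the last claim of (c) are the two sums already found there,
    added by reflection at 1/phi^8.\<close>
  show ?thesis
    using a b1 b2 b3 c1 c2 d e f_part reflect[of 8] rogers_dilog_golden_ratio unfolding L \<phi> by blast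
qed

end
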